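(* Let $\alpha>0$ be irrational, let $u>0$ and $v\ge 1$ be real numbers, and let $\mathcal{P}:\mathbb{R}\to[0,\infty)$ be a sine-like function with period $\alpha$. If $\mu(\alpha)<1+\frac{u}{v}$, then the series $\sum_{n=1}^{\infty}\frac{1}{n^{u}\,\mathcal{P}(n)^{v}}$ converges.
   Context: A function $\mathcal{P}:\mathbb{R}\to[0,\infty)$ is called sine-like with (irrational) period $\alpha>0$ if (1) $\mathcal{P}(x)=\mathcal{P}(x+n\alpha)$ for all real $x$ and all integers $n$, and (2) there are constants $0<B_1\le B_2$ such that $B_1|x|\le\mathcal{P}(x)\le B_2|x|$ whenever $|x|\le\alpha/2$. (For example $|\sin|$ with $\alpha=\pi$; the Flint-Hills series is the case $u=3,v=2$.) Since $\alpha$ is irrational, $\mathcal{P}(n)>0$ for every positive integer $n$. $\mu(\alpha)$ denotes the irrationality measure of $\alpha$: the supremum of all $\mu_0>0$ such that $0<|\alpha-p/q|<q^{-\mu_0}$ has infinitely many integer solutions $(p,q)$ with $q\ge1$. *)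

theory Defs
  imports "HOL-Analysis.Analysis"
begin

text \<open>The supremum is taken in the extended reals, so that Liouville numbers have measure \<open>\<infinity>\<close>.\<close>

definition irrationality_measure :: "real \<Rightarrow> ereal" where
  "irrationality_measure \<alpha> =
     Sup {ereal \<mu> | \<mu> :: real. \<mu> > 0 \<and>
       infinite {(p :: int, q :: int). q \<ge> 1 \<and>
         0 < \<bar>\<alpha> - of_int p / of_int q\<bar> \<and>
         \<bar>\<alpha> - of_int p / of_int q\<bar> < of_int q powr (- \<mu>)}}"

definition sine_like :: "(real \<Rightarrow> real) \<Rightarrow> real \<Rightarrow> bool" where
  "sine_like P \<alpha> \<longleftrightarrow>
     \<alpha> > 0 \<and>
     (\<forall>x. P x \<ge> 0) \<and>
     (\<forall>x. \<forall>n :: int. P x = P (x + of_int n * \<alpha>)) \<and>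
     (\<exists>B1 B2. 0 < B1 \<and> B1 \<le> B2 \<and>
        (\<forall>x. \<bar>x\<bar> \<le> \<alpha> / 2 \<longrightarrow> B1 * \<bar>x\<bar> \<le> P x \<and> P x \<le> B2 * \<bar>x\<bar>))"

end

theory Submission
  imports Defs
begin

text \<open>
  Choose \<open>\<tau>\<close> with \<open>\<mu>(\<alpha>) < 1 + \<tau> < 1 + u/v\<close>. Every positive integer \<open>d\<close> then has distance at least
  \<open>c d\<^sup>-\<^sup>\<tau>\<close> from \<open>\<alpha>\<int>\<close>. Hence the residues modulo \<open>\<alpha>\<close>, taken in \<open>[-\<alpha>/2, \<alpha>/2]\<close>, of the integers of a
  dyadic block \<open>[N, 2N)\<close> are separated from each other and from \<open>0\<close> by some \<open>\<delta> \<asymp> N\<^sup>-\<^sup>\<tau>\<close>, so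
  their absolute values are at least of order \<open>\<delta>, 2\<delta>, 3\<delta>, \<dots>\<close>, and the block sum of \<open>\<P>(n)\<^sup>-\<^sup>w\<close> is
  \<open>O(N\<^bsup>\<tau>w\<^esup>)\<close> for every \<open>w > 1\<close>. Since the residues are bounded, the exponent \<open>v\<close> may be raised to some \<open>w > v\<close>
  with \<open>\<tau>w < u\<close>, which also covers \<open>v = 1\<close>; the block sums then decay geometrically.
\<close>

section \<open>Sums over dyadic blocks and over separated points\<close>

lemma summable_if_dyadic_sums_powr:
  fixes f :: "nat \<Rightarrow> real"
  assumes nonneg: "\<And>n. 0 \<le> f n" and s: "s > 0" and C: "C \<ge> 0"
    and block: "\<And>N. N \<ge> 1 \<Longrightarrow> sum f {N..<2 * N} \<le> C * real N powr (- s)"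
  shows "summable f"
proof (rule summableI_nonneg_bounded)
  fix n
  define r :: real where "r = 2 powr (- s)"
  have r: "0 < r" "r < 1"
    using s by (auto simp: r_def powr_less_one)
  \<comment> \<open>The indices below \<open>2 ^ k\<close> are 0 and the blocks starting at
    \<open>2 ^ i\<close> for \<open>i < k\<close>; the block at \<open>2 ^ i\<close> contributes at
    most \<open>C * r ^ i\<close>.\<close>
  have upto: "sum f {..<2 ^ k} \<le> f 0 + C * (\<Sum>i<k. r ^ i)" for k
  proof (induction k)
    case 0
    then show ?case by (simp add: lessThan_Suc)
  next
    case (Suc k)
    have "real (2 ^ k) powr (- s) = r ^ k"
      by (simp add: r_def powr_realpow[symmetric] powr_powr mult.commute)
    then have "sum f {2 ^ k..<2 * 2 ^ k} \<le> C * r ^ k"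
      using block[of "2 ^ k"] by simp
    moreover have "sum f {..<2 ^ Suc k} = sum f {..<2 ^ k} + sum f {2 ^ k..<2 * 2 ^ k}"
      using sum.atLeastLessThan_concat[of 0 "2 ^ k" "2 * 2 ^ k" f]
      by (simp add: atLeast0LessThan)
    ultimately show ?case
      using Suc by (simp add: algebra_simps)
  qed
  have "n < 2 ^ n"
    by (rule less_exp)
  then have "sum f {..<n} \<le> sum f {..<2 ^ n}"
    using nonneg by (intro sum_mono2) auto
  also have "\<dots> \<le> f 0 + C * (\<Sum>i<n. r ^ i)"
    by (rule upto)
  also have "(\<Sum>i<n. r ^ i) \<le> (\<Sum>i. r ^ i)"
    using r by (intro sum_le_suminf summable_geometric) auto
  finally show "sum f {..<n} \<le> f 0 + C * (\<Sum>i. r ^ i)"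
    using C by (simp add: mult_left_mono)
qed (use nonneg in auto)

lemma sum_abs_int_powr_bounded:
  fixes w :: real
  assumes "w > 1"
  obtains S where "S > 0"
    and "\<And>J :: int set. finite J \<Longrightarrow> (\<Sum>j\<in>J. \<bar>real_of_int j\<bar> powr (- w)) \<le> S"
proof
  let ?g = "\<lambda>n. real n powr (- w)"
  have sm: "summable ?g"
    using assms by (simp add: summable_real_powr_iff)
  \<comment> \<open>The factor 2 accounts for both signs, and the added 1 makes the bound visibly
    positive. A zero in \<open>J\<close> is harmless, since \<open>0 powr (- w) = 0\<close>.\<close>
  show "2 * suminf ?g + 1 > 0"
    using suminf_nonneg[OF sm] by simp
  fix J :: "int set"
  assume "finite J"
  define A where "A = (\<lambda>j. nat \<bar>j\<bar>) ` J"
  have A: "finite A"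
    using \<open>finite J\<close> by (simp add: A_def)
  let ?h = "\<lambda>j. \<bar>real_of_int j\<bar> powr (- w)"
  have "j \<in> int ` A \<union> (\<lambda>n. - int n) ` A" if "j \<in> J" for j
  proof -
    have "nat \<bar>j\<bar> \<in> A"
      using that by (auto simp: A_def)
    moreover have "j = int (nat \<bar>j\<bar>) \<or> j = - int (nat \<bar>j\<bar>)"
      by auto
    ultimately show ?thesis
      by blast
  qed
  then have "sum ?h J \<le> sum ?h (int ` A \<union> (\<lambda>n. - int n) ` A)"
    using A by (intro sum_mono2) auto
  also have "\<dots> \<le> sum ?h (int ` A) + sum ?h ((\<lambda>n. - int n) ` A)"
    using A sum.union_inter[of "int ` A" "(\<lambda>n. - int n) ` A" ?h]
      sum_nonneg[of "int ` A \<inter> (\<lambda>n. - int n) ` A" ?h] by simp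
  also have "\<dots> = 2 * sum ?g A"
    by (subst (1 2) sum.reindex) (auto simp: inj_on_def o_def)
  also have "sum ?g A \<le> suminf ?g"
    using A sm by (intro sum_le_suminf) auto
  finally show "sum ?h J \<le> 2 * suminf ?g + 1"
    by simp
qed

text \<open>Cut the line into half-open cells of length \<delta>. Separation puts at most one point
  into each cell and \<open>away\<close> keeps cell 0 empty, so the sum is compared with one over
  distinct nonzero integers.\<close>

lemma sum_abs_powr_separated_le:
  fixes x :: "'a \<Rightarrow> real"
  assumes "finite A" and \<delta>: "\<delta> > 0" and w: "w > 0"
    and away: "\<And>a. a \<in> A \<Longrightarrow> \<delta> \<le> \<bar>x a\<bar>"
    and sep: "\<And>a b. a \<in> A \<Longrightarrow> b \<in> A \<Longrightarrow> a \<noteq> b \<Longrightarrow> \<delta> \<le> \<bar>x a - x b\<bar>"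
    and S: "\<And>J :: int set. finite J \<Longrightarrow> (\<Sum>j\<in>J. \<bar>real_of_int j\<bar> powr (- w)) \<le> S"
  shows "(\<Sum>a\<in>A. \<bar>x a\<bar> powr (- w)) \<le> (\<delta> / 2) powr (- w) * S"
proof -
  define j where "j a = \<lfloor>x a / \<delta>\<rfloor>" for a
  have lo: "of_int (j a) * \<delta> \<le> x a" for a
    using \<delta> by (simp add: j_def flip: pos_le_divide_eq)
  have hi: "x a < (of_int (j a) + 1) * \<delta>" for a
    using \<delta> by (simp add: j_def flip: pos_divide_less_eq)
  have "inj_on j A"
  proof (rule inj_onI, rule ccontr)
    fix a b
    assume ab: "a \<in> A" "b \<in> A" "j a = j b" "a \<noteq> b"
    have "\<bar>x a - x b\<bar> < \<delta>"
      using lo[of a] hi[of a] lo[of b] hi[of b] ab(3) by (simp add: algebra_simps)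
    with sep[of a b] ab show False
      by simp
  qed
  have "\<bar>x a\<bar> powr (- w) \<le> (\<delta> / 2) powr (- w) * \<bar>of_int (j a)\<bar> powr (- w)" if "a \<in> A" for a
  proof -
    have "j a \<noteq> 0"
      using lo[of a] hi[of a] away[OF that] by auto
    \<comment> \<open>The factor 1/2 is for negative cells: index \<open>- k\<close> only gives a
      modulus above \<open>(k - 1) * \<delta>\<close>, which is at least
      \<open>k * \<delta> / 2\<close> once \<open>k \<ge> 2\<close>. For \<open>k = 1\<close> the
      bound comes from \<open>away\<close>.\<close>
    have "\<delta> / 2 * \<bar>of_int (j a)\<bar> \<le> \<bar>x a\<bar>"
    proof -
      consider "j a \<ge> 1" | "j a = - 1" | "j a \<le> - 2"
        using \<open>j a \<noteq> 0\<close> by linarith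
      then show ?thesis
      proof cases
        case 1
        then have "0 \<le> of_int (j a) * \<delta>"
          using \<delta> by simp
        then show ?thesis
          using lo[of a] 1 by (simp add: algebra_simps)
      next
        case 2
        then show ?thesis
          using away[OF that] \<delta> by simp
      next
        case 3
        then have "real_of_int (j a) \<le> - 2"
          by linarith
        then have "(real_of_int (j a) + 2) * \<delta> \<le> 0"
          using \<delta> by (intro mult_nonpos_nonneg) auto
        then show ?thesis
          using hi[of a] 3 \<delta> by (simp add: algebra_simps)
      qed
    qed
    then have "\<bar>x a\<bar> powr (- w) \<le> (\<delta> / 2 * \<bar>of_int (j a)\<bar>) powr (- w)"
      using w \<delta> \<open>j a \<noteq> 0\<close> by (intro powr_mono2') auto
    then show ?thesis
      using \<delta> by (subst (asm) powr_mult) auto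
  qed
  then have "(\<Sum>a\<in>A. \<bar>x a\<bar> powr (- w))
      \<le> (\<Sum>a\<in>A. (\<delta> / 2) powr (- w) * \<bar>of_int (j a)\<bar> powr (- w))"
    by (rule sum_mono)
  also have "\<dots> = (\<delta> / 2) powr (- w) * (\<Sum>i\<in>j ` A. \<bar>of_int i\<bar> powr (- w))"
    using \<open>inj_on j A\<close> by (simp add: sum.reindex sum_distrib_left)
  also have "\<dots> \<le> (\<delta> / 2) powr (- w) * S"
    using S[of "j ` A"] \<open>finite A\<close> by (intro mult_left_mono) auto
  finally show ?thesis .
qed

section \<open>Diophantine lower bounds from the irrationality measure\<close>

lemma irrationality_measure_lower_bound:
  fixes \<alpha> m :: real
  assumes "\<alpha> \<notin> \<rat>" and "m > 0" and "irrationality_measure \<alpha> < ereal m"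
  obtains c where "c > 0"
    and "\<And>p q :: int. q \<ge> 1 \<Longrightarrow> c * of_int q powr (- m) \<le> \<bar>\<alpha> - of_int p / of_int q\<bar>"
proof -
  \<comment> \<open>The pairs violating the bound with constant 1. There are finitely many, since
    otherwise \<open>m\<close> would be among the exponents in the supremum; shrinking the constant
    absorbs them.\<close>
  define E where "E = {(p :: int, q :: int). q \<ge> 1 \<and>
    0 < \<bar>\<alpha> - of_int p / of_int q\<bar> \<and> \<bar>\<alpha> - of_int p / of_int q\<bar> < of_int q powr (- m)}"
  define R where "R = (\<lambda>(p, q). \<bar>\<alpha> - of_int p / of_int q\<bar> * real_of_int q powr m) ` E"
  have "finite E"
  proof (rule ccontr)
    assume "infinite E"
    then have "ereal m \<le> irrationality_measure \<alpha>"
      unfolding irrationality_measure_def E_def using \<open>m > 0\<close> by (intro Sup_upper) blast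
    with assms(3) show False
      by simp
  qed
  then have R: "finite R"
    by (simp add: R_def)
  have "\<alpha> \<noteq> of_int p / of_int q" for p q :: int
    using \<open>\<alpha> \<notin> \<rat>\<close> by auto
  then have pos: "\<bar>\<alpha> - of_int p / of_int q\<bar> > 0" for p q :: int
    by simp
  \<comment> \<open>The elements of \<open>R\<close> serve the exceptional pairs and are positive by
    the definition of \<open>E\<close>; the 1 serves all other pairs.\<close>
  define c where "c = Min (insert 1 R)"
  have "c > 0"
    using R by (auto simp: c_def R_def E_def)
  moreover have "c * of_int q powr (- m) \<le> \<bar>\<alpha> - of_int p / of_int q\<bar>" if q: "q \<ge> 1" for p q :: int
  proof (cases "(p, q) \<in> E")
    case True
    then have "\<bar>\<alpha> - of_int p / of_int q\<bar> * real_of_int q powr m \<in> R"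
      unfolding R_def by force
    then have "c \<le> \<bar>\<alpha> - of_int p / of_int q\<bar> * real_of_int q powr m"
      using R by (simp add: c_def)
    then show ?thesis
      using q by (simp add: powr_minus field_simps)
  next
    case False
    then have "of_int q powr (- m) \<le> \<bar>\<alpha> - of_int p / of_int q\<bar>"
      using q pos[of p q] by (auto simp: E_def)
    moreover have "c \<le> 1"
      using R by (simp add: c_def)
    then have "c * of_int q powr (- m) \<le> 1 * of_int q powr (- m)"
      by (intro mult_right_mono) auto
    ultimately show ?thesis
      by simp
  qed
  ultimately show ?thesis
    using that by blast
qed

text \<open>If \<open>d\<close> is near \<open>p * \<alpha>\<close>, then \<open>d / p\<close>
  approximates \<alpha> with denominator \<open>p\<close> of order \<open>d\<close>. Multiplying the
  error by \<open>p\<close> turns the exponent \<open>1 + \<tau>\<close> into \<tau>.\<close>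

lemma nat_dist_multiples_lower_bound:
  fixes \<alpha> \<tau> :: real
  assumes "\<alpha> > 0" and "\<alpha> \<notin> \<rat>" and "\<tau> > 0" and "irrationality_measure \<alpha> < ereal (1 + \<tau>)"
  obtains c where "c > 0"
    and "\<And>(d :: nat) (p :: int). d \<ge> 1 \<Longrightarrow> c * real d powr (- \<tau>) \<le> \<bar>real d - of_int p * \<alpha>\<bar>"
proof -
  obtain c where c: "c > 0"
    "\<And>p q :: int. q \<ge> 1 \<Longrightarrow> c * of_int q powr (- (1 + \<tau>)) \<le> \<bar>\<alpha> - of_int p / of_int q\<bar>"
    using irrationality_measure_lower_bound[of \<alpha> "1 + \<tau>"] assms by (metis add_pos_pos zero_less_one)
  \<comment> \<open>The 1 settles distances of at least 1. Otherwise
    \<open>p * \<alpha> < d + 1 \<le> 2 * d\<close>, and \<open>p \<le> 2 / \<alpha> * d\<close>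
    yields the other entry.\<close>
  define c' where "c' = min 1 (c * (2 / \<alpha>) powr (- \<tau>))"
  have "c' > 0"
    using c(1) \<open>\<alpha> > 0\<close> by (simp add: c'_def)
  moreover have "c' * real d powr (- \<tau>) \<le> \<bar>real d - of_int p * \<alpha>\<bar>" if d: "d \<ge> 1" for d :: nat and p :: int
  proof (cases "1 \<le> \<bar>real d - of_int p * \<alpha>\<bar>")
    case True
    have "real d powr (- \<tau>) \<le> 1"
      using d \<open>\<tau> > 0\<close> by (simp add: powr_minus ge_one_powr_ge_zero inverse_le_1_iff)
    then have "c' * real d powr (- \<tau>) \<le> 1 * 1"
      using \<open>c' > 0\<close> by (intro mult_mono) (auto simp: c'_def)
    with True show ?thesis
      by simp
  next
    case False
    then have *: "real d - 1 < of_int p * \<alpha>" "of_int p * \<alpha> < real d + 1"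
      by linarith+
    have "0 < of_int p * \<alpha>"
      using d *(1) by simp
    then have p: "p \<ge> 1"
      using \<open>\<alpha> > 0\<close> by (simp add: zero_less_mult_iff)
    have "of_int p \<le> 2 / \<alpha> * real d"
      using *(2) d \<open>\<alpha> > 0\<close> by (simp add: field_simps)
    then have "(2 / \<alpha> * real d) powr (- \<tau>) \<le> of_int p powr (- \<tau>)"
      using p \<open>\<tau> > 0\<close> by (intro powr_mono2') auto
    then have le: "(2 / \<alpha>) powr (- \<tau>) * real d powr (- \<tau>) \<le> of_int p powr (- \<tau>)"
      using \<open>\<alpha> > 0\<close> by (subst (asm) powr_mult) auto
    have "c' * real d powr (- \<tau>) \<le> c * (2 / \<alpha>) powr (- \<tau>) * real d powr (- \<tau>)"
      by (intro mult_right_mono) (auto simp: c'_def)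
    also have "\<dots> \<le> c * of_int p powr (- \<tau>)"
      using le c(1) by (simp add: mult.assoc)
    also have "\<dots> = of_int p * (c * of_int p powr (- (1 + \<tau>)))"
      using p by (simp add: powr_diff powr_minus field_simps)
    also have "\<dots> \<le> of_int p * \<bar>\<alpha> - of_int (int d) / of_int p\<bar>"
      using c(2)[OF p, of "int d"] p by (intro mult_left_mono) auto
    also have "\<dots> = \<bar>of_int p * (\<alpha> - of_int (int d) / of_int p)\<bar>"
      using p by (simp add: abs_mult)
    also have "of_int p * (\<alpha> - of_int (int d) / of_int p) = of_int p * \<alpha> - real d"
      using p by (simp add: field_simps)
    also have "\<bar>of_int p * \<alpha> - real d\<bar> = \<bar>real d - of_int p * \<alpha>\<bar>"
      by (rule abs_minus_commute)
    finally show ?thesis .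
  qed
  ultimately show ?thesis
    using that by blast
qed

section \<open>Residues modulo \<alpha> and convergence of the series\<close>

lemma centered_residue_exists:
  fixes \<alpha> y :: real
  assumes "\<alpha> > 0"
  shows "\<exists>p :: int. \<bar>y - of_int p * \<alpha>\<bar> \<le> \<alpha> / 2"
proof
  have "y - of_int (round (y / \<alpha>)) * \<alpha> = (y / \<alpha> - of_int (round (y / \<alpha>))) * \<alpha>"
    using assms by (simp add: field_simps)
  then have "\<bar>y - of_int (round (y / \<alpha>)) * \<alpha>\<bar> = \<bar>of_int (round (y / \<alpha>)) - y / \<alpha>\<bar> * \<alpha>"
    using assms by (simp add: abs_mult abs_minus_commute)
  also have "\<dots> \<le> 1 / 2 * \<alpha>"
    using assms of_int_round_abs_le[of "y / \<alpha>"] by (intro mult_right_mono) auto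
  finally show "\<bar>y - of_int (round (y / \<alpha>)) * \<alpha>\<bar> \<le> \<alpha> / 2"
    by simp
qed

theorem theorem5:
  fixes \<alpha> u v :: real and P :: "real \<Rightarrow> real"
  assumes "\<alpha> > 0" and "\<alpha> \<notin> \<rat>"
    and "u > 0" and "v \<ge> 1"
    and "sine_like P \<alpha>"
    and "irrationality_measure \<alpha> < ereal (1 + u / v)"
  shows "summable (\<lambda>n :: nat. 1 / (real (Suc n) powr u * P (real (Suc n)) powr v))"
proof -
  \<comment> \<open>The maximum with 1 forces \<open>m > 1\<close>, hence
    \<open>\<tau> > 0\<close>.\<close>
  have "max (irrationality_measure \<alpha>) 1 < ereal (1 + u / v)"
    using assms by (simp add: one_ereal_def)
  then obtain m where m: "max (irrationality_measure \<alpha>) 1 < ereal m" "m < 1 + u / v"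
    using ereal_dense2[of "max (irrationality_measure \<alpha>) 1" "ereal (1 + u / v)"] by auto
  define \<tau> where "\<tau> = m - 1"
  have \<tau>: "\<tau> > 0" "\<tau> * v < u" and "irrationality_measure \<alpha> < ereal (1 + \<tau>)"
    using m \<open>v \<ge> 1\<close> by (simp_all add: \<tau>_def one_ereal_def field_simps)
  then obtain c where c: "c > 0"
    "\<And>(d :: nat) (p :: int). d \<ge> 1 \<Longrightarrow> c * real d powr (- \<tau>) \<le> \<bar>real d - of_int p * \<alpha>\<bar>"
    using nat_dist_multiples_lower_bound assms(1,2) by blast
  \<comment> \<open>The midpoint of \<open>v\<close> and \<open>u / \<tau>\<close>, where
    \<open>v < u / \<tau>\<close> by the choice of \<tau>.\<close>
  define w where "w = (v + u / \<tau>) / 2"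
  have "v < w" "\<tau> * w < u"
    using \<tau> by (simp_all add: w_def field_simps)
  then have "w > 1"
    using \<open>v \<ge> 1\<close> by simp
  then obtain S where S: "S > 0"
    "\<And>J :: int set. finite J \<Longrightarrow> (\<Sum>j\<in>J. \<bar>real_of_int j\<bar> powr (- w)) \<le> S"
    using sum_abs_int_powr_bounded by metis

  have "\<exists>p. \<forall>n. \<bar>real n - of_int (p n) * \<alpha>\<bar> \<le> \<alpha> / 2"
    using centered_residue_exists[OF \<open>\<alpha> > 0\<close>] by (intro choice) blast
  then obtain p :: "nat \<Rightarrow> int" where p: "\<And>n. \<bar>real n - of_int (p n) * \<alpha>\<bar> \<le> \<alpha> / 2"
    by blast
  define x where "x n = real n - of_int (p n) * \<alpha>" for n
  have x_le: "\<bar>x n\<bar> \<le> \<alpha> / 2" for n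
    using p by (simp add: x_def)
  have per: "P y = P (y + of_int k * \<alpha>)" for y and k :: int
    using assms(5) unfolding sine_like_def by blast
  have Px: "P (real n) = P (x n)" for n
    using per[of "real n" "- p n"] by (simp add: x_def)
  obtain B where B: "B > 0" "\<And>y. \<bar>y\<bar> \<le> \<alpha> / 2 \<Longrightarrow> B * \<bar>y\<bar> \<le> P y"
    using assms(5) unfolding sine_like_def by blast

  define f where "f n = (if n = 0 then 0 else 1 / (real n powr u * P (real n) powr v))" for n
  \<comment> \<open>The second factor is the price of raising the exponent from \<open>v\<close> to
    \<open>w\<close>, as the residues are at most \<open>\<alpha> / 2\<close> in modulus.\<close>
  define K where "K = B powr (- v) * (\<alpha> / 2) powr (w - v)"
  define C where "C = K * S * (c / 2) powr (- w) * 2 powr (\<tau> * w)"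
  have "K > 0"
    using B \<open>\<alpha> > 0\<close> by (simp add: K_def)
  have away: "c * real D powr (- \<tau>) \<le> \<bar>real d - of_int k * \<alpha>\<bar>" if "1 \<le> d" "d \<le> D" for d D k
  proof -
    have "real D powr (- \<tau>) \<le> real d powr (- \<tau>)"
      using that \<tau> by (intro powr_mono2') auto
    then have "c * real D powr (- \<tau>) \<le> c * real d powr (- \<tau>)"
      using c(1) by simp
    also have "\<dots> \<le> \<bar>real d - of_int k * \<alpha>\<bar>"
      using c(2) that by blast
    finally show ?thesis .
  qed

  have term_le: "f n \<le> real N powr (- u) * K * \<bar>x n\<bar> powr (- w)" if "1 \<le> N" "N \<le> n" for n N
  proof -
    \<comment> \<open>Strict positivity matters: \<open>0 powr (- v)\<close> is 0, so negative
      powers are antitone only away from 0.\<close>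
    have "0 < c * real n powr (- \<tau>)"
      using c(1) that by simp
    also have "\<dots> \<le> \<bar>x n\<bar>"
      unfolding x_def using that by (intro away) auto
    finally have x_pos: "\<bar>x n\<bar> > 0" .
    have "P (real n) powr (- v) \<le> (B * \<bar>x n\<bar>) powr (- v)"
      using B(1) B(2)[OF x_le[of n]] x_pos \<open>v \<ge> 1\<close> by (intro powr_mono2') (auto simp: Px)
    also have "\<dots> = B powr (- v) * (\<bar>x n\<bar> powr (w - v) * \<bar>x n\<bar> powr (- w))"
      using B(1) by (simp add: powr_mult flip: powr_add)
    also have "\<dots> \<le> B powr (- v) * ((\<alpha> / 2) powr (w - v) * \<bar>x n\<bar> powr (- w))"
      using x_le[of n] \<open>v < w\<close> by (intro mult_left_mono mult_right_mono powr_mono2) auto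
    finally have "P (real n) powr (- v) \<le> K * \<bar>x n\<bar> powr (- w)"
      by (simp add: K_def mult.assoc)
    moreover have "real n powr (- u) \<le> real N powr (- u)"
      using that \<open>u > 0\<close> by (intro powr_mono2') auto
    ultimately have "real n powr (- u) * P (real n) powr (- v)
        \<le> real N powr (- u) * (K * \<bar>x n\<bar> powr (- w))"
      by (intro mult_mono) auto
    then show ?thesis
      using that by (simp add: f_def powr_minus field_simps)
  qed

  have "sum f {N..<2 * N} \<le> C * real N powr (- (u - \<tau> * w))" if N: "N \<ge> 1" for N
  proof -
    \<comment> \<open>Indices in the block and their differences are all at most
      \<open>2 * N\<close>, so one \<delta> bounds both the residues and their gaps.\<close>
    define \<delta> where "\<delta> = c * real (2 * N) powr (- \<tau>)"
    have "\<delta> > 0"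
      using c(1) N by (simp add: \<delta>_def)
    have sep: "\<delta> \<le> \<bar>x a - x b\<bar>" if "a < b" "b < 2 * N" for a b
    proof -
      \<comment> \<open>A difference of residues is, up to sign, the offset of the integer
        \<open>b - a\<close> from a multiple of \<alpha>, so \<open>away\<close> applies
        again.\<close>
      have "\<delta> \<le> \<bar>real (b - a) - of_int (p b - p a) * \<alpha>\<bar>"
        unfolding \<delta>_def using that by (intro away) auto
      also have "\<dots> = \<bar>x a - x b\<bar>"
        using that by (simp add: x_def of_nat_diff algebra_simps)
      finally show ?thesis .
    qed
    have "(\<Sum>n\<in>{N..<2 * N}. \<bar>x n\<bar> powr (- w)) \<le> (\<delta> / 2) powr (- w) * S"
    proof (rule sum_abs_powr_separated_le)
      show "\<delta> \<le> \<bar>x a\<bar>" if "a \<in> {N..<2 * N}" for a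
        unfolding \<delta>_def x_def using that N by (intro away) auto
      show "\<delta> \<le> \<bar>x a - x b\<bar>" if "a \<in> {N..<2 * N}" "b \<in> {N..<2 * N}" "a \<noteq> b" for a b
        using sep[of a b] sep[of b a] that by (cases "a < b") (auto simp: abs_minus_commute)
    qed (use \<open>\<delta> > 0\<close> \<open>w > 1\<close> S in auto)
    also have "(\<delta> / 2) powr (- w) = (c / 2 * real (2 * N) powr (- \<tau>)) powr (- w)"
      by (simp add: \<delta>_def)
    also have "\<dots> = (c / 2) powr (- w) * real (2 * N) powr (\<tau> * w)"
      using c(1) by (subst powr_mult) (auto simp: powr_powr)
    also have "real (2 * N) powr (\<tau> * w) = 2 powr (\<tau> * w) * real N powr (\<tau> * w)"
      by (simp add: powr_mult)
    finally have sum_x: "(\<Sum>n\<in>{N..<2 * N}. \<bar>x n\<bar> powr (- w))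
        \<le> (c / 2) powr (- w) * (2 powr (\<tau> * w) * real N powr (\<tau> * w)) * S" .
    have "sum f {N..<2 * N} \<le> (\<Sum>n\<in>{N..<2 * N}. real N powr (- u) * K * \<bar>x n\<bar> powr (- w))"
      using N by (intro sum_mono term_le) auto
    also have "\<dots> = real N powr (- u) * K * (\<Sum>n\<in>{N..<2 * N}. \<bar>x n\<bar> powr (- w))"
      by (simp add: sum_distrib_left)
    also have "\<dots> \<le> real N powr (- u) * K *
        ((c / 2) powr (- w) * (2 powr (\<tau> * w) * real N powr (\<tau> * w)) * S)"
      using \<open>K > 0\<close> by (intro mult_left_mono sum_x) auto
    also have "\<dots> = C * (real N powr (- u) * real N powr (\<tau> * w))"
      by (simp add: C_def mult_ac)
    also have "\<dots> = C * real N powr (- (u - \<tau> * w))"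
      by (simp flip: powr_add)
    finally show ?thesis .
  qed
  moreover have "0 \<le> C"
    using \<open>K > 0\<close> S(1) by (simp add: C_def)
  moreover have "0 \<le> f n" for n
    by (simp add: f_def)
  ultimately have "summable f"
    using \<open>\<tau> * w < u\<close> by (intro summable_if_dyadic_sums_powr[of f "u - \<tau> * w" C]) auto
  \<comment> \<open>The value \<open>f 0\<close> is only a filler; the index shift removes
    it.\<close>
  then show ?thesis
    by (subst (asm) summable_Suc_iff[symmetric]) (simp add: f_def)
qed

end
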